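(* Let $d,m\in\mathbb N$ and let $\Psi=\{\Psi_k\}_{k\in\mathbb Z^d}$ be a sequence of complex numbers, $\Psi_k\ne 0$, such that there exists a non-increasing rearrangement $\bar\Psi=\{\bar\Psi_j\}_{j=1}^\infty$ of the system $\{|\Psi_k|\}_{k\in\mathbb Z^d}$. (i) If $0<q<p=\infty$ or $p=q=\infty$, then $$E_{\gamma_m}(\mathcal F_q^\Psi)_{\mathcal S^p}=\mathscr E_{\gamma_m}(\mathcal F_q^\Psi)_{\mathcal S^p}=\bar\Psi_{\gamma_m}(1)\qquad\text{for all }\gamma_m\in\Gamma_m,$$ and $$\mathscr D_m(\mathcal F_q^\Psi)_{\mathcal S^p}=\mathscr D_m^\perp(\mathcal F_q^\Psi)_{\mathcal S^p}=\bar\Psi_{m+1}.$$ (ii) If $0<p<q=\infty$ and the series $\sum_{k\in\mathbb Z^d}|\Psi_k|^p$ converges, then $$E_{\gamma_m}(\mathcal F_q^\Psi)_{\mathcal S^p}=\mathscr E_{\gamma_m}(\mathcal F_q^\Psi)_{\mathcal S^p}=\Big(\sum_{j=1}^\infty \bar\Psi_{\gamma_m}^{\,p}(j)\Big)^{1/p}\qquad\text{for all }\gamma_m\in\Gamma_m,$$ and $$\mathscr D_m(\mathcal F_q^\Psi)_{\mathcal S^p}=\mathscr D_m^\perp(\mathcal F_q^\Psi)_{\mathcal S^p}=\Big(\sum_{j=m+1}^\infty \bar\Psi_j^{\,p}\Big)^{1/p}.$$ Moreover, in both cases, for any collection $\gamma_m^*=\{k_1,\dots,k_m\}\in\Gamma_m$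 with $|\Psi_{k_j}|=\bar\Psi_j$, $j=1,\dots,m$, $$\mathscr D_m(\mathcal F_q^\Psi)_{\mathcal S^p}=\mathscr D_m^\perp(\mathcal F_q^\Psi)_{\mathcal S^p}=E_{\gamma_m^*}(\mathcal F_q^\Psi)_{\mathcal S^p}=\mathscr E_{\gamma_m^*}(\mathcal F_q^\Psi)_{\mathcal S^p}.$$
   Context: $L_1=L_1(\mathbb T^d)$, $\mathbb T^d=[0,2\pi)^d$, is the space of functions integrable on $\mathbb T^d$ and $2\pi$-periodic in each variable; $e_k(x)=e^{i(k,x)}$ and $\widehat f(k)=(2\pi)^{-d}\int_{\mathbb T^d}f(x)\overline{e_k(x)}\,dx$, $k\in\mathbb Z^d$. For $0<p\le\infty$, $\mathcal S^p$ is the space of $f\in L_1$ with finite $\|f\|_{\mathcal S^p}=\|\{\widehat f(k)\}_{k\in\mathbb Z^d}\|_{\ell_p(\mathbb Z^d)}$ (with $\sup_k|\widehat f(k)|$ for $p=\infty$). For $0<q\le\infty$, $\mathcal F_q^\Psi=\{f\in L_1:\ \|\{\widehat f(k)/\Psi_k\}_{k\in\mathbb Z^d}\|_{\ell_q(\mathbb Z^d)}\le1\}$. $\Gamma_m$ is the set of all collections $\gamma_m$ of $m$ different vectors of $\mathbb Z^d$. For $f\in\mathcal S^p$: $E_{\gamma_m}(f)_{\mathcal S^p}=\inf_{c_k\in\mathbb C}\|f-\sum_{k\in\gamma_m}c_ke_k\|_{\mathcal S^p}$ and $\mathscr E_{\gamma_m}(f)_{\mathcal S^p}=\|f-\sum_{k\in\gamma_m}\widehat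 f(k)e_k\|_{\mathcal S^p}$. For a set $\mathfrak N\subset\mathcal S^p$: $E_{\gamma_m}(\mathfrak N)_{\mathcal S^p}=\sup_{f\in\mathfrak N}E_{\gamma_m}(f)_{\mathcal S^p}$, $\mathscr E_{\gamma_m}(\mathfrak N)_{\mathcal S^p}=\sup_{f\in\mathfrak N}\mathscr E_{\gamma_m}(f)_{\mathcal S^p}$, $\mathscr D_m(\mathfrak N)_{\mathcal S^p}=\inf_{\gamma_m\in\Gamma_m}E_{\gamma_m}(\mathfrak N)_{\mathcal S^p}$, $\mathscr D_m^\perp(\mathfrak N)_{\mathcal S^p}=\inf_{\gamma_m\in\Gamma_m}\mathscr E_{\gamma_m}(\mathfrak N)_{\mathcal S^p}$. For $\gamma_m\in\Gamma_m$, put $\Psi_{\gamma_m}(k)=0$ if $k\in\gamma_m$ and $\Psi_{\gamma_m}(k)=\Psi_k$ if $k\notin\gamma_m$; $\bar\Psi_{\gamma_m}=\{\bar\Psi_{\gamma_m}(j)\}_{j=1}^\infty$ is the non-increasing rearrangement of $\{|\Psi_{\gamma_m}(k)|\}_{k\in\mathbb Z^d}$ (the $j$-th term is the $j$-th largest value, counted with multiplicity). *)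

theory Defs
  imports "HOL-Analysis.Analysis"
begin

definition torus :: "(real ^ 'd) set" where
  "torus = {x. \<forall>i. 0 \<le> x $ i \<and> x $ i < 2 * pi}"

text \<open>Functions are not identified up to null sets; all quantities below depend on a
  function only through its Fourier coefficients.\<close>

definition L1_per :: "(real ^ 'd \<Rightarrow> complex) set" where
  "L1_per = {f. f absolutely_integrable_on torus \<and>
                (\<forall>x i. f (x + axis i (2 * pi)) = f x)}"

definition e_exp :: "int ^ 'd \<Rightarrow> real ^ 'd \<Rightarrow> complex" where
  "e_exp k x = exp (\<i> * complex_of_real (\<Sum>i\<in>UNIV. of_int (k $ i) * x $ i))"

definition fourier_coeff :: "(real ^ 'd \<Rightarrow> complex) \<Rightarrow> int ^ 'd \<Rightarrow> complex" where
  "fourier_coeff f k =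
     (LINT x:torus|lebesgue. f x * cnj (e_exp k x)) / complex_of_real ((2 * pi) ^ CARD('d))"

text \<open>The norm (quasi-norm if \<open>p < 1\<close>) takes the value \<open>\<infinity>\<close> outside the space; the value
  for \<open>p = 0\<close> is irrelevant.\<close>

definition lp_norm :: "ennreal \<Rightarrow> ('i \<Rightarrow> complex) \<Rightarrow> ennreal" where
  "lp_norm p a =
     (if p = \<infinity> then (SUP k. ennreal (cmod (a k)))
      else if (\<lambda>k. cmod (a k) powr enn2real p) summable_on UNIV
        then ennreal ((\<Sum>\<^sub>\<infinity>k. cmod (a k) powr enn2real p) powr (1 / enn2real p))
      else \<infinity>)"

definition Sp_norm :: "ennreal \<Rightarrow> (real ^ 'd \<Rightarrow> complex) \<Rightarrow> ennreal" where
  "Sp_norm p f = lp_norm p (fourier_coeff f)"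

definition F_class :: "ennreal \<Rightarrow> (int ^ 'd \<Rightarrow> complex) \<Rightarrow> (real ^ 'd \<Rightarrow> complex) set" where
  "F_class q \<Psi> = {f \<in> L1_per. lp_norm q (\<lambda>k. fourier_coeff f k / \<Psi> k) \<le> 1}"

definition Gam :: "nat \<Rightarrow> (int ^ 'd) set set" where
  "Gam m = {\<gamma>. finite \<gamma> \<and> card \<gamma> = m}"

definition best_approx :: "ennreal \<Rightarrow> (int ^ 'd) set \<Rightarrow> (real ^ 'd \<Rightarrow> complex) \<Rightarrow> ennreal" where
  "best_approx p \<gamma> f =
     (INF c :: int ^ 'd \<Rightarrow> complex. Sp_norm p (\<lambda>x. f x - (\<Sum>k\<in>\<gamma>. c k * e_exp k x)))"

definition fourier_approx :: "ennreal \<Rightarrow> (int ^ 'd) set \<Rightarrow> (real ^ 'd \<Rightarrow> complex) \<Rightarrow> ennreal" where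
  "fourier_approx p \<gamma> f =
     Sp_norm p (\<lambda>x. f x - (\<Sum>k\<in>\<gamma>. fourier_coeff f k * e_exp k x))"

definition best_approx_class ::
    "ennreal \<Rightarrow> (int ^ 'd) set \<Rightarrow> (real ^ 'd \<Rightarrow> complex) set \<Rightarrow> ennreal" where
  "best_approx_class p \<gamma> N = (SUP f\<in>N. best_approx p \<gamma> f)"

definition fourier_approx_class ::
    "ennreal \<Rightarrow> (int ^ 'd) set \<Rightarrow> (real ^ 'd \<Rightarrow> complex) set \<Rightarrow> ennreal" where
  "fourier_approx_class p \<gamma> N = (SUP f\<in>N. fourier_approx p \<gamma> f)"

definition basis_width :: "ennreal \<Rightarrow> nat \<Rightarrow> (real ^ 'd \<Rightarrow> complex) set \<Rightarrow> ennreal" where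
  "basis_width p m N = (INF \<gamma>\<in>Gam m. best_approx_class p \<gamma> N)"

definition projection_width :: "ennreal \<Rightarrow> nat \<Rightarrow> (real ^ 'd \<Rightarrow> complex) set \<Rightarrow> ennreal" where
  "projection_width p m N = (INF \<gamma>\<in>Gam m. fourier_approx_class p \<gamma> N)"

text \<open>Rearrangements are indexed from 1; the value at index 0 is irrelevant.\<close>

definition nonincreasing_rearrangement :: "('i \<Rightarrow> real) \<Rightarrow> (nat \<Rightarrow> real) \<Rightarrow> bool" where
  "nonincreasing_rearrangement a b \<longleftrightarrow>
     antimono_on {1..} b \<and> (\<exists>\<sigma>. bij_betw \<sigma> {1..} UNIV \<and> (\<forall>j\<ge>1. b j = a (\<sigma> j)))"

definition off :: "('i \<Rightarrow> complex) \<Rightarrow> 'i set \<Rightarrow> 'i \<Rightarrow> complex" where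
  "off \<Psi> \<gamma> k = (if k \<in> \<gamma> then 0 else \<Psi> k)"

text \<open>The \<open>j\<close>-th largest value of a family, counted with multiplicity (\<open>j \<ge> 1\<close>): fewer than
  \<open>j\<close> members exceed it and at least \<open>j\<close> members (possibly infinitely many) reach it.
  A bijective rearrangement is not available for a family with infinitely many positive members
  and some zeros, such as \<open>off \<Psi> \<gamma>\<close>. Where a bijective rearrangement does exist, the two
  notions agree, as shown below.\<close>

definition is_jth_largest :: "('i \<Rightarrow> real) \<Rightarrow> nat \<Rightarrow> real \<Rightarrow> bool" where
  "is_jth_largest a j v \<longleftrightarrow>
     finite {k. a k > v} \<and> card {k. a k > v} < j \<and>
     (infinite {k. a k \<ge> v} \<or> j \<le> card {k. a k \<ge> v})"

definition jth_largest :: "('i \<Rightarrow> real) \<Rightarrow> nat \<Rightarrow> real" where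
  "jth_largest a j = (THE v. is_jth_largest a j v)"

lemma is_jth_largest_le:
  assumes "is_jth_largest a j v" "is_jth_largest a j w"
  shows "w \<le> v"
proof (rule ccontr)
  assume "\<not> w \<le> v"
  then have sub: "{k. a k \<ge> w} \<subseteq> {k. a k > v}" by auto
  have fin: "finite {k. a k > v}" and lt: "card {k. a k > v} < j"
    using assms(1) by (auto simp: is_jth_largest_def)
  have "j \<le> card {k. a k \<ge> w}"
    using assms(2) finite_subset[OF sub fin] by (auto simp: is_jth_largest_def)
  with card_mono[OF fin sub] lt show False by linarith
qed

lemma jth_largest_eqI:
  assumes "is_jth_largest a j v"
  shows "jth_largest a j = v"
  unfolding jth_largest_def
  using assms by (blast intro: the_equality antisym is_jth_largest_le)

lemma jth_largest_eq_rearrangement: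
  assumes "nonincreasing_rearrangement a b" "j \<ge> 1"
  shows "jth_largest a j = b j"
proof (rule jth_largest_eqI)
  obtain \<sigma> where anti: "antimono_on {1..} b" and bij: "bij_betw \<sigma> {1..} UNIV"
    and b: "\<And>i. i \<ge> 1 \<Longrightarrow> b i = a (\<sigma> i)"
    using assms(1) by (auto simp: nonincreasing_rearrangement_def)
  have le: "b i' \<le> b i" if "1 \<le> i" "i \<le> i'" for i i'
    using anti that by (auto simp: monotone_on_def)
  have sub1: "{k. a k > b j} \<subseteq> \<sigma> ` {1..<j}"
  proof
    fix k assume k: "k \<in> {k. a k > b j}"
    have "k \<in> \<sigma> ` {1..}" using bij by (simp add: bij_betw_def)
    then obtain i where i: "i \<ge> 1" "k = \<sigma> i" by auto
    have "i < j"
    proof (rule ccontr)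
      assume "\<not> i < j"
      then have "b i \<le> b j" using le assms(2) by simp
      with k i b show False by simp
    qed
    with i show "k \<in> \<sigma> ` {1..<j}" by auto
  qed
  have sub2: "\<sigma> ` {1..j} \<subseteq> {k. a k \<ge> b j}"
    using b le by auto
  have "inj_on \<sigma> {1..j}"
    using bij by (auto simp: bij_betw_def intro: inj_on_subset)
  then have card2: "card (\<sigma> ` {1..j}) = j" by (simp add: card_image)
  have "card {k. a k > b j} \<le> card (\<sigma> ` {1..<j})" using sub1 by (simp add: card_mono)
  also have "\<dots> \<le> card {1..<j}" by (rule card_image_le) simp
  finally have "card {k. a k > b j} < j" using assms(2) by simp
  moreover have "finite {k. a k > b j}" using sub1 finite_subset by blast
  moreover have "j \<le> card {k. a k \<ge> b j}" if "finite {k. a k \<ge> b j}"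
    using card_mono[OF that sub2] card2 by simp
  ultimately show "is_jth_largest a j (b j)" by (auto simp: is_jth_largest_def)
qed

end

theory Submission
  imports Defs
begin

text \<open>Subtracting a trigonometric polynomial with spectrum in \<open>\<gamma>\<close> changes only the coefficients
  with index in \<open>\<gamma>\<close>, so the Fourier sum is the best approximation, and its error is the
  \<open>l\<^sub>p\<close>-norm of the coefficients outside \<open>\<gamma>\<close>. On the class these are dominated by
  \<open>\<bar>\<Psi>\<^sub>k\<bar>\<close>. If \<open>p = \<infinity>\<close>, the single harmonics \<open>\<Psi>\<^sub>k e\<^sub>k\<close> show that the bound is sharp. If
  \<open>q = \<infinity>\<close>, the finite sums \<open>\<Sum>\<^sub>k \<Psi>\<^sub>k e\<^sub>k\<close> lie in the class and their norms approach the bound;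
  for \<open>p > 2\<close> an integrable function with all coefficients equal to \<open>\<Psi>\<^sub>k\<close> need not exist.
  Either way the error of the class is the norm of \<open>off \<Psi> \<gamma>\<close>, which is smallest when \<open>\<gamma>\<close>
  removes \<open>m\<close> largest members of the family.\<close>

subsection \<open>Fourier coefficients of trigonometric polynomials\<close>

text \<open>Fubini for integrands that factor over the coordinates: \<open>lborel\<close> is the
  image of a product of real Lebesgue measures, and the coordinates of the image point are the
  factors' variables.\<close>

lemma integral_prod_Basis:
  fixes G :: "'a::euclidean_space \<Rightarrow> real \<Rightarrow> complex"
  assumes G: "\<And>b. b \<in> Basis \<Longrightarrow> integrable lborel (G b)"
  shows "(LINT x|lborel. (\<Prod>b\<in>Basis. G b (x \<bullet> b))) = (\<Prod>b\<in>Basis. LINT t|lborel. G b t)"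
proof -
  interpret product_sigma_finite "\<lambda>b::'a. lborel :: real measure" ..
  have [measurable]: "G b \<in> borel_measurable borel" if "b \<in> Basis" for b
    using G[OF that] by (auto dest: borel_measurable_integrable)
  have "(LINT x|lborel. (\<Prod>b\<in>Basis. G b (x \<bullet> b)))
      = (LINT f|(\<Pi>\<^sub>M b\<in>Basis. lborel). (\<Prod>b\<in>Basis. G b ((\<Sum>c\<in>Basis. f c *\<^sub>R c :: 'a) \<bullet> b)))"
    by (subst lborel_eq, subst integral_distr) simp_all
  also have "\<dots> = (LINT f|(\<Pi>\<^sub>M b\<in>Basis. lborel). (\<Prod>b\<in>Basis. G b (f b)))"
    by (intro Bochner_Integration.integral_cong prod.cong refl) simp
  also have "\<dots> = (\<Prod>b\<in>Basis. LINT t|lborel. G b t)"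
    by (intro product_integral_prod) (auto intro: G)
  finally show ?thesis .
qed

text \<open>One-dimensional orthogonality over a period, with the indicator inside \<open>g\<close>
  so that the whole factor can enter a product integral. The interval is half-open, as in
  \<open>torus\<close>.\<close>

lemma integral_exp_period:
  fixes n :: int
  defines "g \<equiv> \<lambda>t. indicator {0..<2 * pi} t *\<^sub>R exp (\<i> * complex_of_real (of_int n * t))"
  shows "integrable lborel g" and "(LINT t|lborel. g t) = (if n = 0 then of_real (2 * pi) else 0)"
proof -
  let ?e = "\<lambda>t. exp (\<i> * complex_of_real (of_int n * t))"
  have cont: "continuous_on A ?e" for A by (intro continuous_intros)
  have "set_integrable lborel {0..2 * pi} ?e"
    by (intro borel_integrable_atLeastAtMost') (rule cont)
  then have "set_integrable lborel {0..<2 * pi} ?e"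
    by (rule set_integrable_subset) auto
  then show int: "integrable lborel g"
    by (simp add: set_integrable_def g_def)
  \<comment> \<open>A primitive of the exponential; frequency 0 is split off because the general
    formula would divide by zero.\<close>
  let ?F = "\<lambda>t. if n = 0 then complex_of_real t else ?e t / (\<i> * of_int n)"
  have "(LINT t|lborel. g t) = (LINT t|lborel. indicator {0..2 * pi} t *\<^sub>R ?e t)"
  proof (rule integral_cong_AE)
    \<comment> \<open>The two integrands differ only at the endpoint \<open>2 * pi\<close>, a null
      set.\<close>
    show "AE t in lborel. g t = indicator {0..2 * pi} t *\<^sub>R ?e t"
      using AE_lborel_singleton[of "2 * pi"] by eventually_elim (auto simp: g_def indicator_def)
  qed (use int in \<open>auto dest: borel_measurable_integrable\<close>)
  also have "\<dots> = ?F (2 * pi) - ?F 0"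
  proof (rule integral_FTC_atLeastAtMost)
    fix t :: real
    show "(?F has_vector_derivative ?e t) (at t within {0..2 * pi})"
    proof (cases "n = 0")
      case True
      then show ?thesis
        by (auto intro!: derivative_eq_intros has_vector_derivative_of_real[of "\<lambda>t. t" 1, simplified])
    next
      case False
      have "((\<lambda>z. exp (\<i> * of_int n * z) / (\<i> * of_int n)) has_field_derivative exp (\<i> * of_int n * of_real t))
          (at (of_real t))"
        using False by (auto intro!: derivative_eq_intros)
      from has_vector_derivative_real_field[OF this] False show ?thesis
        by (simp add: mult.assoc)
    qed
  qed (use cont in simp_all)
  also have "\<dots> = (if n = 0 then of_real (2 * pi) else 0)"
  proof -
    have "exp (\<i> * (of_int n * (2 * complex_of_real pi))) = 1"
      using exp_integer_2pi[of "of_int n"] by (simp add: mult_ac)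
    then show ?thesis by simp
  qed
  finally show "(LINT t|lborel. g t) = (if n = 0 then of_real (2 * pi) else 0)" .
qed

section \<open>Harmonics on the torus\<close>

lemma continuous_on_e_exp: "continuous_on A (e_exp k)"
  unfolding e_exp_def by (intro continuous_intros)

lemma borel_measurable_e_exp [measurable]: "e_exp k \<in> borel_measurable borel"
  by (rule borel_measurable_continuous_onI) (rule continuous_on_e_exp)

lemma norm_e_exp [simp]: "cmod (e_exp k x) = 1"
  unfolding e_exp_def by (simp only: norm_exp_i_times)

lemma torus_eq_Basis: "torus = {x :: real ^ 'd. \<forall>b\<in>Basis. 0 \<le> x \<bullet> b \<and> x \<bullet> b < 2 * pi}"
  by (auto simp: torus_def Basis_vec_def cart_eq_inner_axis)

lemma torus_borel [measurable]: "torus \<in> sets (borel :: (real ^ 'd) measure)"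
  unfolding torus_eq_Basis by measurable

lemma torus_lmeasurable: "(torus :: (real ^ 'd) set) \<in> lmeasurable"
proof (rule bounded_set_imp_lmeasurable)
  have "torus \<subseteq> cbox 0 (\<chi> i::'d. 2 * pi)"
    unfolding torus_def mem_box_cart subset_iff by (simp add: less_imp_le)
  then show "bounded (torus :: (real ^ 'd) set)"
    using bounded_cbox bounded_subset by blast
qed (use torus_borel in auto)

lemma e_exp_mult_cnj: "e_exp k x * cnj (e_exp l x) = e_exp (k - l) x"
  unfolding e_exp_def exp_cnj
  by (simp add: exp_add[symmetric] algebra_simps sum_subtractf)

text \<open>The harmonic and the indicator of the torus both factor over the coordinates, so the
  integral is a product of one-dimensional ones, and one nonzero frequency makes it vanish.\<close>

lemma integral_e_exp_torus:
  fixes n :: "int ^ 'd"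
  shows "(LINT x:torus|lebesgue. e_exp n x)
     = (if n = 0 then complex_of_real ((2 * pi) ^ CARD('d)) else 0)"
proof -
  \<comment> \<open>\<open>v n b\<close> is the frequency belonging to the basis vector
    \<open>b\<close>; the sum selects the component \<open>n $ i\<close> when
    \<open>b = axis i 1\<close>, so no inverse of \<open>axis\<close> is required.\<close>
  define v :: "int ^ 'd \<Rightarrow> real ^ 'd \<Rightarrow> int" where "v n b = (\<Sum>i\<in>UNIV. n $ i * (if b = axis i 1 then 1 else 0))" for n b
  have v: "v n (axis i 1) = n $ i" for i
    by (simp add: v_def axis_eq_axis if_distrib cong: if_cong)
  define G where "G b t = indicator {0..<2 * pi} t *\<^sub>R exp (\<i> * complex_of_real (of_int (v n b) * t))"
    for b t
  have inj: "inj (\<lambda>i::'d. axis i (1::real))" by (simp add: inj_def axis_eq_axis)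
  have B: "(Basis :: (real ^ 'd) set) = range (\<lambda>i. axis i 1)" by (auto simp: Basis_vec_def)
  have eq: "indicator torus x *\<^sub>R e_exp n x = (\<Prod>b\<in>Basis. G b (x \<bullet> b))" for x
  proof -
    have "e_exp n x = (\<Prod>b\<in>Basis. exp (\<i> * complex_of_real (of_int (v n b) * (x \<bullet> b))))"
      unfolding e_exp_def B
      by (simp add: prod.reindex[OF inj] v exp_sum[symmetric] sum_distrib_left flip: cart_eq_inner_axis)
    moreover have "indicator torus x = (\<Prod>b\<in>Basis. indicator {0..<2 * pi} (x \<bullet> b) :: real)"
      by (auto simp: torus_eq_Basis indicator_def prod_zero_iff)
    ultimately show ?thesis
      by (simp add: G_def scaleR_conv_of_real prod.distrib)
  qed
  have "(LINT x:torus|lebesgue. e_exp n x) = (LINT x|lborel. indicator torus x *\<^sub>R e_exp n x)"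
    unfolding set_lebesgue_integral_def by (rule integral_completion) measurable
  also have "\<dots> = (\<Prod>b\<in>Basis. LINT t|lborel. G b t)"
    unfolding eq using integral_exp_period(1) by (intro integral_prod_Basis) (simp add: G_def[abs_def])
  also have "\<dots> = (\<Prod>b\<in>(Basis :: (real ^ 'd) set). if v n b = 0 then complex_of_real (2 * pi) else 0)"
    using integral_exp_period(2) by (simp add: G_def)
  also have "\<dots> = (\<Prod>i\<in>(UNIV :: 'd set). if n $ i = 0 then complex_of_real (2 * pi) else 0)"
    unfolding B by (simp add: prod.reindex[OF inj] v)
  also have "\<dots> = (if n = 0 then complex_of_real ((2 * pi) ^ CARD('d)) else 0)"
  proof (cases "n = 0")
    case False
    then obtain i where "n $ i \<noteq> 0" by (auto simp: vec_eq_iff)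
    then have "(\<Prod>i\<in>(UNIV :: 'd set). if n $ i = 0 then complex_of_real (2 * pi) else 0) = 0"
      by (intro prod_zero) auto
    with False show ?thesis by simp
  qed simp
  finally show ?thesis .
qed

lemma set_integrable_mult_cnj_e_exp:
  fixes f :: "real ^ 'd \<Rightarrow> complex"
  assumes "f absolutely_integrable_on torus"
  shows "set_integrable lebesgue torus (\<lambda>x. f x * cnj (e_exp k x))"
  unfolding set_integrable_def
proof (rule Bochner_Integration.integrable_bound)
  show int: "integrable lebesgue (\<lambda>x. indicator torus x *\<^sub>R f x)"
    using assms by (simp add: set_integrable_def)
  have [measurable]: "e_exp k \<in> borel_measurable lebesgue"
    by (rule measurable_completion) simp
  then have "(\<lambda>x. (indicator torus x *\<^sub>R f x) * cnj (e_exp k x)) \<in> borel_measurable lebesgue"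
    using borel_measurable_integrable[OF int]
    by (intro borel_measurable_times borel_measurable_continuous_on[where f = cnj] continuous_intros) simp_all
  then show "(\<lambda>x. indicator torus x *\<^sub>R (f x * cnj (e_exp k x))) \<in> borel_measurable lebesgue"
    by simp
qed (auto simp: norm_mult)

text \<open>The constant 1 is integrable on the bounded torus, and multiplying it by the conjugate
  of the harmonic with frequency \<open>- k\<close> gives \<open>e_exp k\<close>.\<close>

lemma e_exp_absolutely_integrable: "e_exp k absolutely_integrable_on torus"
proof -
  have "set_integrable lebesgue torus (\<lambda>x. 1 * cnj (e_exp (- k) x))"
    by (intro set_integrable_mult_cnj_e_exp absolutely_integrable_on_const torus_lmeasurable)
  moreover have "1 * cnj (e_exp (- k) x) = e_exp k x" for x
    by (simp add: e_exp_def exp_cnj sum_negf)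
  ultimately show ?thesis by simp
qed

text \<open>After multiplication by the conjugate of \<open>e_exp l\<close>, each harmonic
  \<open>e_exp k\<close> becomes \<open>e_exp (k - l)\<close>, whose integral survives only for
  \<open>k = l\<close>; the normalising constant then cancels.\<close>

lemma fourier_coeff_diff_trig_poly:
  fixes f :: "real ^ 'd \<Rightarrow> complex"
  assumes f: "f absolutely_integrable_on torus" and "finite \<gamma>"
  shows "fourier_coeff (\<lambda>x. f x - (\<Sum>k\<in>\<gamma>. c k * e_exp k x)) l
     = fourier_coeff f l - (if l \<in> \<gamma> then c l else 0)"
proof -
  let ?N = "complex_of_real ((2 * pi) ^ CARD('d))"
  have E: "set_integrable lebesgue torus (\<lambda>x. c k * (e_exp k x * cnj (e_exp l x)))" for k
    by (intro set_integrable_mult_right) (use set_integrable_mult_cnj_e_exp[OF e_exp_absolutely_integrable] in blast)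
  have "(LINT x:torus|lebesgue. (f x - (\<Sum>k\<in>\<gamma>. c k * e_exp k x)) * cnj (e_exp l x))
      = (LINT x:torus|lebesgue. f x * cnj (e_exp l x)
          - (\<Sum>k\<in>\<gamma>. c k * (e_exp k x * cnj (e_exp l x))))"
    by (simp add: left_diff_distrib sum_distrib_right mult.assoc)
  also have "\<dots> = (LINT x:torus|lebesgue. f x * cnj (e_exp l x))
      - (LINT x:torus|lebesgue. \<Sum>k\<in>\<gamma>. c k * (e_exp k x * cnj (e_exp l x)))"
    using E \<open>finite \<gamma>\<close> by (intro set_integral_diff set_integrable_mult_cnj_e_exp[OF f] absolutely_integrable_sum) auto
  also have "(LINT x:torus|lebesgue. \<Sum>k\<in>\<gamma>. c k * (e_exp k x * cnj (e_exp l x)))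
      = (\<Sum>k\<in>\<gamma>. LINT x:torus|lebesgue. c k * (e_exp k x * cnj (e_exp l x)))"
    using E unfolding set_lebesgue_integral_def set_integrable_def scaleR_sum_right
    by (rule Bochner_Integration.integral_sum)
  also have "\<dots> = (\<Sum>k\<in>\<gamma>. c k * (if k = l then ?N else 0))"
    by (simp add: e_exp_mult_cnj integral_e_exp_torus)
  also have "\<dots> = (if l \<in> \<gamma> then c l * ?N else 0)"
    using \<open>finite \<gamma>\<close> by (simp add: if_distrib cong: if_cong)
  finally show ?thesis
    by (simp add: fourier_coeff_def diff_divide_distrib)
qed

lemma e_exp_periodic: "e_exp k (x + axis i (2 * pi)) = e_exp k x"
proof -
  have "(\<Sum>j\<in>UNIV. of_int (k $ j) * (x + axis i (2 * pi)) $ j)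
      = (\<Sum>j\<in>UNIV. of_int (k $ j) * x $ j) + of_int (k $ i) * (2 * pi)"
  proof -
    have "of_int (k $ j) * (x + axis i (2 * pi)) $ j
        = of_int (k $ j) * x $ j + (if j = i then of_int (k $ i) * (2 * pi) else 0)" for j
      by (simp add: axis_def distrib_left)
    then show ?thesis by (simp add: sum.distrib)
  qed
  then show ?thesis
    using exp_integer_2pi[of "of_int (k $ i)"]
    by (simp add: e_exp_def distrib_left exp_add mult_ac)
qed

lemma trig_poly_L1_per: "(\<lambda>x. \<Sum>k\<in>F. c k * e_exp k x) \<in> L1_per"
  if "finite F"
  using that e_exp_absolutely_integrable
  by (auto simp: L1_per_def e_exp_periodic intro!: absolutely_integrable_sum)

lemma fourier_coeff_trig_poly:
  assumes "finite F"
  shows "fourier_coeff (\<lambda>x. \<Sum>k\<in>F. c k * e_exp k x) l = (if l \<in> F then c l else 0)"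
proof -
  \<comment> \<open>The polynomial is read as zero minus a polynomial with negated coefficients, so
    that the difference formula applies.\<close>
  have "fourier_coeff (\<lambda>x. 0 - (\<Sum>k\<in>F. (- c k) * e_exp k x)) l
     = fourier_coeff (\<lambda>x. 0) l - (if l \<in> F then - c l else 0)"
    using assms by (intro fourier_coeff_diff_trig_poly) (auto simp: set_integrable_def)
  then show ?thesis
    by (simp add: sum_negf fourier_coeff_def)
qed

subsection \<open>Rearrangements\<close>

text \<open>Members strictly above \<open>a (\<tau> j)\<close> lie among the first
  \<open>j - 1\<close> values of \<open>\<tau>\<close>, while all \<open>j\<close> of its values
  reach that level. Since \<open>\<tau>\<close> need not be onto, the criterion also suits families
  padded with zeros.\<close>

lemma is_jth_largestI:
  fixes a :: "'i \<Rightarrow> real" and \<tau> :: "nat \<Rightarrow> 'i"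
  assumes "j \<ge> 1" and inj: "inj_on \<tau> {1..j}"
    and ge: "\<And>i. i \<in> {1..j} \<Longrightarrow> a (\<tau> j) \<le> a (\<tau> i)"
    and le: "\<And>k. k \<notin> \<tau> ` {1..j} \<Longrightarrow> a k \<le> a (\<tau> j)"
  shows "is_jth_largest a j (a (\<tau> j))"
proof -
  have sub: "{k. a k > a (\<tau> j)} \<subseteq> \<tau> ` {1..<j}"
  proof
    fix k assume k: "k \<in> {k. a k > a (\<tau> j)}"
    then obtain i where "i \<in> {1..j}" "k = \<tau> i" using le by fastforce
    with k show "k \<in> \<tau> ` {1..<j}" by (cases "i = j") auto
  qed
  have fin: "finite {k. a k > a (\<tau> j)}" using finite_subset[OF sub] by simp
  have "card {k. a k > a (\<tau> j)} \<le> card (\<tau> ` {1..<j})" using sub by (simp add: card_mono)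
  also have "\<dots> \<le> card {1..<j}" by (rule card_image_le) simp
  finally have lt: "card {k. a k > a (\<tau> j)} < j" using \<open>j \<ge> 1\<close> by simp
  have "j \<le> card {k. a k \<ge> a (\<tau> j)}" if "finite {k. a k \<ge> a (\<tau> j)}"
  proof -
    have "j = card (\<tau> ` {1..j})" using inj by (simp add: card_image)
    also have "\<dots> \<le> card {k. a k \<ge> a (\<tau> j)}" using that ge by (intro card_mono) auto
    finally show ?thesis .
  qed
  with fin lt show ?thesis by (auto simp: is_jth_largest_def)
qed

text \<open>Walking through the sorted family and skipping the positions in \<open>\<gamma>\<close>
  sorts what is left. The zeros placed on \<open>\<gamma>\<close> never exceed a remaining modulus,
  so they do not disturb the ordered values.\<close>

lemma rearrangement_off:
  assumes "nonincreasing_rearrangement (\<lambda>k. cmod (\<Psi> k)) b" and "finite \<gamma>"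
  obtains \<tau> where "bij_betw \<tau> {1..} (- \<gamma>)"
    and "\<And>j. j \<ge> 1 \<Longrightarrow> jth_largest (\<lambda>k. cmod (off \<Psi> \<gamma> k)) j = cmod (\<Psi> (\<tau> j))"
    and "\<And>k. cmod (off \<Psi> \<gamma> k) \<le> cmod (\<Psi> (\<tau> 1))"
proof -
  obtain \<sigma> where anti: "antimono_on {1..} b" and bij: "bij_betw \<sigma> {1..} UNIV"
    and b: "\<And>i. i \<ge> 1 \<Longrightarrow> b i = cmod (\<Psi> (\<sigma> i))"
    using assms(1) by (auto simp: nonincreasing_rearrangement_def)
  define J where "J = {j\<in>{1..}. \<sigma> j \<notin> \<gamma>}"
  have inj: "inj_on \<sigma> {1..}" using bij by (rule bij_betw_imp_inj_on)
  have bijJ: "bij_betw \<sigma> J (- \<gamma>)"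
    using bij unfolding bij_betw_def J_def by (auto intro: inj_on_subset)
  have "infinite J"
  proof
    assume "finite J"
    moreover have "{1..} - J \<subseteq> \<sigma> -` \<gamma> \<inter> {1..}" by (auto simp: J_def)
    moreover have "finite (\<sigma> -` \<gamma> \<inter> {1..})" using \<open>finite \<gamma>\<close> inj by (rule finite_vimage_IntI)
    ultimately have "finite (J \<union> ({1..} - J))" by (meson finite_UnI finite_subset)
    then show False using infinite_Ici[of "1::nat"] by (auto dest: finite_subset[rotated])
  qed
  \<comment> \<open>\<open>enumerate\<close> counts from 0 and rearrangements from 1. Truncated
    subtraction gives \<open>e 0 = e 1\<close>, so the facts below hold at index 0 as well.\<close>
  define e where "e = (\<lambda>j. enumerate J (j - 1))"
  define \<tau> where "\<tau> = \<sigma> \<circ> e"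
  have "bij_betw (\<lambda>j. j - 1) {1..} (UNIV :: nat set)"
    by (rule bij_betw_byWitness[where f' = Suc]) auto
  then have "bij_betw e {1..} J"
    using bij_betw_trans[OF _ bij_enumerate[OF \<open>infinite J\<close>]] by (simp add: e_def comp_def)
  then have bij\<tau>: "bij_betw \<tau> {1..} (- \<gamma>)"
    unfolding \<tau>_def using bijJ by (rule bij_betw_trans)
  have e: "e i \<in> J" for i using \<open>infinite J\<close> by (simp add: e_def enumerate_in_set)
  have mono: "cmod (\<Psi> (\<tau> j)) \<le> cmod (\<Psi> (\<tau> i))" if "i \<le> j" for i j
  proof -
    have "e i \<le> e j" using that \<open>infinite J\<close> by (simp add: e_def)
    moreover have "e i \<ge> 1" "e j \<ge> 1" using e by (auto simp: J_def)
    ultimately have "b (e j) \<le> b (e i)" using anti by (auto simp: monotone_on_def)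
    with b \<open>e i \<ge> 1\<close> \<open>e j \<ge> 1\<close> show ?thesis by (simp add: \<tau>_def)
  qed
  have \<tau>: "\<tau> j \<notin> \<gamma>" for j using e[of j] by (simp add: \<tau>_def J_def)
  have le: "cmod (off \<Psi> \<gamma> k) \<le> cmod (\<Psi> (\<tau> j))" if "k \<notin> \<tau> ` {1..<j}" for k j
  proof (cases "k \<in> \<gamma>")
    case False
    then have "k \<in> \<tau> ` {1..}" using bij\<tau> by (auto simp: bij_betw_def)
    then obtain i where "i \<ge> 1" "k = \<tau> i" by auto
    with that have "j \<le> i" by fastforce
    with mono False \<open>k = \<tau> i\<close> show ?thesis by (simp add: off_def)
  qed (simp add: off_def)
  show thesis
  proof (rule that[OF bij\<tau>])
    fix j :: nat assume j: "j \<ge> 1"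
    have "is_jth_largest (\<lambda>k. cmod (off \<Psi> \<gamma> k)) j (cmod (off \<Psi> \<gamma> (\<tau> j)))"
    proof (rule is_jth_largestI[OF j])
      show "inj_on \<tau> {1..j}"
        using bij\<tau> by (auto simp: bij_betw_def intro: inj_on_subset)
      show "cmod (off \<Psi> \<gamma> (\<tau> j)) \<le> cmod (off \<Psi> \<gamma> (\<tau> i))" if "i \<in> {1..j}" for i
        using that mono \<tau> by (simp add: off_def)
      show "cmod (off \<Psi> \<gamma> k) \<le> cmod (off \<Psi> \<gamma> (\<tau> j))" if "k \<notin> \<tau> ` {1..j}" for k
      proof -
        have "k \<notin> \<tau> ` {1..<j}" using that by auto
        from le[OF this] \<tau> show ?thesis by (simp add: off_def)
      qed
    qed
    then show "jth_largest (\<lambda>k. cmod (off \<Psi> \<gamma> k)) j = cmod (\<Psi> (\<tau> j))"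
      using \<tau> by (auto simp: off_def dest: jth_largest_eqI)
  next
    show "cmod (off \<Psi> \<gamma> k) \<le> cmod (\<Psi> (\<tau> 1))" for k using le[of k 1] by simp
  qed
qed

text \<open>An exchange argument: the part of \<open>J\<close> beyond the initial segment and the
  part of the segment missing from \<open>J\<close> have equal size, and \<open>b (card J)\<close>
  separates the terms of the two.\<close>

lemma sum_antimono_le_initial:
  fixes b :: "nat \<Rightarrow> real"
  assumes anti: "antimono_on {1..} b" and J: "finite J" "J \<subseteq> {1..}"
  shows "sum b J \<le> sum b {1..card J}"
proof -
  let ?m = "card J" and ?I = "{1..card J}"
  have "card J = card (J \<inter> ?I) + card (J - ?I)"
    using card_Int_Diff[OF \<open>finite J\<close>] by blast
  moreover have "card ?I = card (?I \<inter> J) + card (?I - J)"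
    using card_Int_Diff[of ?I J] by blast
  ultimately have card: "card (J - ?I) = card (?I - J)"
    by (simp add: Int_commute)
  have "sum b (J - ?I) \<le> real (card (J - ?I)) * b ?m"
  proof (rule sum_bounded_above)
    fix i assume "i \<in> J - ?I"
    moreover from this have "card J \<ge> 1" using J(1) by (auto simp: Suc_le_eq card_gt_0_iff)
    ultimately show "b i \<le> b ?m" using anti J(2) by (auto simp: monotone_on_def)
  qed
  also have "\<dots> \<le> sum b (?I - J)"
    unfolding card
  proof (rule sum_bounded_below)
    fix i assume "i \<in> ?I - J"
    then show "b ?m \<le> b i" using anti by (auto simp: monotone_on_def)
  qed
  finally have "sum b (J \<inter> ?I) + sum b (J - ?I) \<le> sum b (?I \<inter> J) + sum b (?I - J)"
    by (simp add: Int_commute)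
  then show ?thesis
    using sum.Int_Diff[OF J(1), of b ?I] sum.Int_Diff[of ?I b J] by simp
qed

subsection \<open>Approximation errors of the class\<close>

lemma lp_norm_mono:
  assumes "\<And>k. cmod (a k) \<le> cmod (b k)"
  shows "lp_norm p a \<le> lp_norm p b"
proof (cases "p = \<infinity>")
  case True
  then show ?thesis
    using assms by (auto simp: lp_norm_def intro!: SUP_mono ennreal_leI)
next
  case False
  let ?r = "enn2real p"
  have le: "cmod (a k) powr ?r \<le> cmod (b k) powr ?r" for k
    using assms by (intro powr_mono2) auto
  show ?thesis
  proof (cases "(\<lambda>k. cmod (b k) powr ?r) summable_on UNIV")
    case sb: True
    then have sa: "(\<lambda>k. cmod (a k) powr ?r) summable_on UNIV"
      by (rule summable_on_comparison_test) (use le in auto)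
    have "(\<Sum>\<^sub>\<infinity>k. cmod (a k) powr ?r) powr (1 / ?r) \<le> (\<Sum>\<^sub>\<infinity>k. cmod (b k) powr ?r) powr (1 / ?r)"
      by (intro powr_mono2 infsum_mono[OF sa sb le] infsum_nonneg) auto
    with False sa sb show ?thesis by (simp add: lp_norm_def ennreal_leI)
  qed (use False in \<open>simp add: lp_norm_def\<close>)
qed

text \<open>For finite \<open>p\<close>, a single term of a nonnegative series is at most its sum;
  positivity of \<open>p\<close> lets the root undo the power.\<close>

lemma cmod_le_lp_norm:
  assumes "p > 0"
  shows "ennreal (cmod (a k)) \<le> lp_norm p a"
proof (cases "p = \<infinity>")
  case True
  then show ?thesis by (auto simp: lp_norm_def intro: SUP_upper)
next
  case False
  then have r: "enn2real p > 0" using assms by (simp add: enn2real_positive_iff top.not_eq_extremum)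
  show ?thesis
  proof (cases "(\<lambda>k. cmod (a k) powr enn2real p) summable_on UNIV")
    case s: True
    have "cmod (a k) = (cmod (a k) powr enn2real p) powr (1 / enn2real p)"
      using r by (simp add: powr_powr)
    also have "\<dots> \<le> (\<Sum>\<^sub>\<infinity>k. cmod (a k) powr enn2real p) powr (1 / enn2real p)"
      using r finite_sum_le_infsum[OF s, of "{k}"] by (intro powr_mono2) auto
    finally show ?thesis using False s by (simp add: lp_norm_def ennreal_leI)
  qed (use False in \<open>simp add: lp_norm_def\<close>)
qed

lemma lp_norm_finite_support:
  assumes "p \<noteq> \<infinity>" "finite F" and "\<And>k. k \<notin> F \<Longrightarrow> a k = 0"
  shows "lp_norm p a = ennreal ((\<Sum>k\<in>F. cmod (a k) powr enn2real p) powr (1 / enn2real p))"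
proof -
  let ?g = "\<lambda>k. cmod (a k) powr enn2real p"
  have "(?g has_sum sum ?g F) F" using \<open>finite F\<close> by (rule has_sum_finite)
  then have "(?g has_sum sum ?g F) UNIV"
    by (subst (asm) has_sum_cong_neutral[of UNIV F ?g ?g]) (use assms(3) in auto)
  then show ?thesis
    using \<open>p \<noteq> \<infinity>\<close> by (auto simp: lp_norm_def infsumI summable_on_def)
qed

text \<open>This puts each single harmonic, scaled by its \<open>\<Psi> k\<close>, into the class
  for every positive \<open>q\<close>.\<close>

lemma lp_norm_unit:
  assumes "p > 0"
  shows "lp_norm p (\<lambda>l. if l = k then 1 else 0) = 1"
proof (cases "p = \<infinity>")
  case True
  have "(SUP l. ennreal (cmod (if l = k then 1 else 0))) = 1"
    by (rule antisym) (auto intro!: SUP_least SUP_upper2[of k])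
  with True show ?thesis by (simp add: lp_norm_def)
next
  case False
  then show ?thesis
    using lp_norm_finite_support[OF False, of "{k}" "\<lambda>l. if l = k then 1 else 0"] by simp
qed

text \<open>An infinite sum of nonnegative terms is bounded by any common bound of its finite
  partial sums. For finite \<open>S\<close> the bound is raised to the power \<open>p\<close> and
  the root taken at the end; infinite \<open>S\<close> is trivial.\<close>

lemma lp_norm_le_finite_truncations:
  assumes p: "0 < p" "p \<noteq> \<infinity>" and s: "(\<lambda>k. cmod (a k) powr enn2real p) summable_on UNIV"
    and S: "\<And>F. finite F \<Longrightarrow> lp_norm p (\<lambda>k. if k \<in> F then a k else 0) \<le> S"
  shows "lp_norm p a \<le> S"
proof (cases S)
  case (real t)
  let ?r = "enn2real p"
  have r: "?r > 0" using p by (simp add: enn2real_positive_iff top.not_eq_extremum)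
  have "(\<Sum>\<^sub>\<infinity>k. cmod (a k) powr ?r) \<le> t powr ?r"
  proof (rule infsum_le_finite_sums[OF s])
    fix F :: "'a set" assume "finite F"
    have "lp_norm p (\<lambda>k. if k \<in> F then a k else 0)
        = ennreal ((\<Sum>k\<in>F. cmod (a k) powr ?r) powr (1 / ?r))"
      using \<open>finite F\<close> p by (subst lp_norm_finite_support[of p F]) auto
    with S[OF \<open>finite F\<close>] real have "(\<Sum>k\<in>F. cmod (a k) powr ?r) powr (1 / ?r) \<le> t"
      by simp
    then have "((\<Sum>k\<in>F. cmod (a k) powr ?r) powr (1 / ?r)) powr ?r \<le> t powr ?r"
      using r by (intro powr_mono2) auto
    then show "(\<Sum>k\<in>F. cmod (a k) powr ?r) \<le> t powr ?r"
      using r by (simp add: powr_powr sum_nonneg)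
  qed
  then have "(\<Sum>\<^sub>\<infinity>k. cmod (a k) powr ?r) powr (1 / ?r) \<le> (t powr ?r) powr (1 / ?r)"
    using r by (intro powr_mono2 infsum_nonneg) auto
  also have "\<dots> = t" using r real by (simp add: powr_powr)
  finally show ?thesis using p s real by (simp add: lp_norm_def ennreal_leI)
qed simp

section \<open>Fourier sums as best approximations\<close>

lemma fourier_approx_eq:
  assumes "f \<in> L1_per" "finite \<gamma>"
  shows "fourier_approx p \<gamma> f = lp_norm p (off (fourier_coeff f) \<gamma>)"
proof -
  have "fourier_coeff (\<lambda>x. f x - (\<Sum>k\<in>\<gamma>. fourier_coeff f k * e_exp k x)) = off (fourier_coeff f) \<gamma>"
    using assms by (auto simp: L1_per_def fourier_coeff_diff_trig_poly off_def)
  then show ?thesis by (simp add: fourier_approx_def Sp_norm_def)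
qed

text \<open>Fourier coefficients are one admissible choice of \<open>c\<close>. Any other choice
  leaves the coefficients outside \<open>\<gamma>\<close> unchanged and can only replace the zeros
  on \<open>\<gamma>\<close>, so monotonicity of the norm gives the converse.\<close>

lemma best_approx_eq_fourier_approx:
  assumes "f \<in> L1_per" "finite \<gamma>"
  shows "best_approx p \<gamma> f = fourier_approx p \<gamma> f"
proof (rule antisym)
  show "best_approx p \<gamma> f \<le> fourier_approx p \<gamma> f"
    unfolding best_approx_def fourier_approx_def by (rule INF_lower) simp
  show "fourier_approx p \<gamma> f \<le> best_approx p \<gamma> f"
    unfolding best_approx_def fourier_approx_eq[OF assms] Sp_norm_def
    using assms
    by (intro INF_greatest lp_norm_mono) (simp add: L1_per_def fourier_coeff_diff_trig_poly off_def)
qed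

lemma best_approx_class_eq_fourier_approx_class:
  assumes "finite \<gamma>"
  shows "best_approx_class p \<gamma> (F_class q \<Psi>) = fourier_approx_class p \<gamma> (F_class q \<Psi>)"
  unfolding best_approx_class_def fourier_approx_class_def
  using assms by (intro SUP_cong) (auto simp: best_approx_eq_fourier_approx F_class_def)

lemma fourier_approx_class_eq:
  assumes \<Psi>: "\<And>k. \<Psi> k \<noteq> 0" and \<gamma>: "finite \<gamma>" and "0 < p" "0 < q"
    and pq: "p = \<infinity> \<or> q = \<infinity> \<and> (\<lambda>k. cmod (\<Psi> k) powr enn2real p) summable_on UNIV"
  shows "fourier_approx_class p \<gamma> (F_class q \<Psi>) = lp_norm p (off \<Psi> \<gamma>)"
proof (rule antisym)
  show "fourier_approx_class p \<gamma> (F_class q \<Psi>) \<le> lp_norm p (off \<Psi> \<gamma>)"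
    unfolding fourier_approx_class_def
  proof (rule SUP_least)
    fix f assume f: "f \<in> F_class q \<Psi>"
    have "cmod (fourier_coeff f k) \<le> cmod (\<Psi> k)" for k
    proof -
      have "ennreal (cmod (fourier_coeff f k / \<Psi> k)) \<le> 1"
        using cmod_le_lp_norm[OF \<open>0 < q\<close>, of "\<lambda>k. fourier_coeff f k / \<Psi> k" k] f
        by (auto simp: F_class_def simp del: ennreal_le_1 intro: order_trans)
      then show ?thesis using \<Psi>[of k] by (simp add: norm_divide)
    qed
    then show "fourier_approx p \<gamma> f \<le> lp_norm p (off \<Psi> \<gamma>)"
      using f \<gamma> by (auto simp: fourier_approx_eq F_class_def off_def intro!: lp_norm_mono)
  qed
  \<comment> \<open>The bound is conditional on the indicator of \<open>F\<close> having
    \<open>q\<close>-norm at most 1, so that it covers singletons for every \<open>q\<close> and all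
    finite sets for \<open>q = \<infinity>\<close>.\<close>
  have trig: "lp_norm p (\<lambda>k. if k \<in> F then off \<Psi> \<gamma> k else 0) \<le> fourier_approx_class p \<gamma> (F_class q \<Psi>)"
    if F: "finite F" and "lp_norm q (\<lambda>k. if k \<in> F then 1 else 0) \<le> 1" for F
  proof -
    \<comment> \<open>The quotients of the coefficients of \<open>f\<close> by \<open>\<Psi>\<close>
      form exactly the indicator of \<open>F\<close>.\<close>
    define f where "f = (\<lambda>x. \<Sum>k\<in>F. \<Psi> k * e_exp k x)"
    have c: "fourier_coeff f = (\<lambda>k. if k \<in> F then \<Psi> k else 0)"
      using F by (simp add: f_def fourier_coeff_trig_poly fun_eq_iff)
    have "(\<lambda>k. fourier_coeff f k / \<Psi> k) = (\<lambda>k. if k \<in> F then 1 else 0)"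
      using \<Psi> by (auto simp: c)
    then have f: "f \<in> F_class q \<Psi>"
      using that trig_poly_L1_per[OF F] by (simp add: F_class_def f_def)
    have "off (fourier_coeff f) \<gamma> = (\<lambda>k. if k \<in> F then off \<Psi> \<gamma> k else 0)"
      by (auto simp: c off_def)
    then have "fourier_approx p \<gamma> f = lp_norm p (\<lambda>k. if k \<in> F then off \<Psi> \<gamma> k else 0)"
      using f \<gamma> by (simp add: fourier_approx_eq F_class_def)
    with f show ?thesis by (auto simp: fourier_approx_class_def intro: SUP_upper2)
  qed
  show "lp_norm p (off \<Psi> \<gamma>) \<le> fourier_approx_class p \<gamma> (F_class q \<Psi>)"
  proof (cases "p = \<infinity>")
    case True
    have "ennreal (cmod (off \<Psi> \<gamma> k)) \<le> fourier_approx_class p \<gamma> (F_class q \<Psi>)" for k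
      using trig[of "{k}"] lp_norm_unit[OF \<open>0 < q\<close>, of k]
        cmod_le_lp_norm[OF \<open>0 < p\<close>, of "\<lambda>l. if l \<in> {k} then off \<Psi> \<gamma> l else 0" k]
      by (auto intro: order_trans)
    with True show ?thesis by (auto simp: lp_norm_def intro: SUP_least)
  next
    case False
    with pq have q: "q = \<infinity>" and s: "(\<lambda>k. cmod (\<Psi> k) powr enn2real p) summable_on UNIV" by auto
    have "(\<lambda>k. cmod (off \<Psi> \<gamma> k) powr enn2real p) summable_on UNIV"
      using s by (rule summable_on_comparison_test) (auto simp: off_def)
    then show ?thesis
    proof (rule lp_norm_le_finite_truncations[OF \<open>0 < p\<close> False])
      fix F :: "(int ^ 'a) set" assume "finite F"
      moreover have "lp_norm q (\<lambda>k. if k \<in> F then 1 else 0) \<le> 1"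
        by (auto simp: q lp_norm_def intro!: SUP_least)
      ultimately show "lp_norm p (\<lambda>k. if k \<in> F then off \<Psi> \<gamma> k else 0)
          \<le> fourier_approx_class p \<gamma> (F_class q \<Psi>)"
        by (rule trig)
    qed
  qed
qed

subsection \<open>Extremal spectra\<close>

text \<open>The total sum does not depend on \<open>\<gamma>\<close>, so making the error small
  amounts to making the finite sum over \<open>\<gamma>\<close> large.\<close>

lemma lp_norm_off:
  assumes "finite \<gamma>" "p \<noteq> \<infinity>" and s: "(\<lambda>k. cmod (\<Psi> k) powr enn2real p) summable_on UNIV"
  shows "lp_norm p (off \<Psi> \<gamma>)
     = ennreal ((\<Sum>\<^sub>\<infinity>k\<in>- \<gamma>. cmod (\<Psi> k) powr enn2real p) powr (1 / enn2real p))"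
    and "(\<Sum>\<^sub>\<infinity>k\<in>- \<gamma>. cmod (\<Psi> k) powr enn2real p)
     = (\<Sum>\<^sub>\<infinity>k. cmod (\<Psi> k) powr enn2real p) - (\<Sum>k\<in>\<gamma>. cmod (\<Psi> k) powr enn2real p)"
proof -
  let ?g = "\<lambda>k. cmod (\<Psi> k) powr enn2real p"
  have "(\<lambda>k. cmod (off \<Psi> \<gamma> k) powr enn2real p) summable_on UNIV"
    using s by (rule summable_on_comparison_test) (auto simp: off_def)
  moreover have "(\<Sum>\<^sub>\<infinity>k. cmod (off \<Psi> \<gamma> k) powr enn2real p) = (\<Sum>\<^sub>\<infinity>k\<in>- \<gamma>. ?g k)"
    by (rule infsum_cong_neutral) (auto simp: off_def)
  ultimately show "lp_norm p (off \<Psi> \<gamma>) = ennreal ((\<Sum>\<^sub>\<infinity>k\<in>- \<gamma>. ?g k) powr (1 / enn2real p))"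
    using \<open>p \<noteq> \<infinity>\<close> by (simp add: lp_norm_def)
  have "infsum ?g (\<gamma> \<union> - \<gamma>) = infsum ?g \<gamma> + infsum ?g (- \<gamma>)"
    using s by (intro infsum_Un_disjoint) (auto intro: summable_on_subset_banach)
  then show "infsum ?g (- \<gamma>) = infsum ?g UNIV - sum ?g \<gamma>"
    using \<open>finite \<gamma>\<close> by simp
qed

section \<open>Lower bounds and attainment for spectra of \<open>m\<close> elements\<close>

context
  fixes \<Psi> :: "int ^ 'd \<Rightarrow> complex" and b :: "nat \<Rightarrow> real" and \<sigma> :: "nat \<Rightarrow> int ^ 'd"
  assumes anti: "antimono_on {1..} b" and bij: "bij_betw \<sigma> {1..} UNIV"
    and b: "\<And>j. j \<ge> 1 \<Longrightarrow> b j = cmod (\<Psi> (\<sigma> j))"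
begin

lemma inj_on_\<sigma>: "J \<subseteq> {1..} \<Longrightarrow> inj_on \<sigma> J"
  using bij by (auto simp: bij_betw_def intro: inj_on_subset)

lemma \<sigma>_image_Gam: "\<sigma> ` {1..m} \<in> Gam m"
  by (simp add: Gam_def card_image inj_on_\<sigma>)

lemma b_nonneg: "j \<ge> 1 \<Longrightarrow> 0 \<le> b j"
  by (simp add: b)

lemma b_mono: "1 \<le> i \<Longrightarrow> i \<le> j \<Longrightarrow> b j \<le> b i"
  using anti by (auto simp: monotone_on_def)

text \<open>Pigeonhole: the \<open>m + 1\<close> leading indices cannot all lie in a set of
  \<open>m\<close> elements, and one that escapes has modulus at least
  \<open>b (m + 1)\<close>.\<close>

lemma lp_norm_infinity_off_ge:
  assumes "\<gamma> \<in> Gam m"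
  shows "ennreal (b (m + 1)) \<le> lp_norm \<infinity> (off \<Psi> \<gamma>)"
proof -
  have "\<not> \<sigma> ` {1..m + 1} \<subseteq> \<gamma>"
  proof
    assume "\<sigma> ` {1..m + 1} \<subseteq> \<gamma>"
    then have "card (\<sigma> ` {1..m + 1}) \<le> m" using assms by (auto simp: Gam_def intro: card_mono)
    then show False by (simp add: card_image inj_on_\<sigma>)
  qed
  then obtain j where j: "j \<in> {1..m + 1}" "\<sigma> j \<notin> \<gamma>" by blast
  then have "b (m + 1) \<le> cmod (off \<Psi> \<gamma> (\<sigma> j))"
    using b_mono[of j "m + 1"] b[of j] by (simp add: off_def)
  then have "ennreal (b (m + 1)) \<le> ennreal (cmod (off \<Psi> \<gamma> (\<sigma> j)))" by (rule ennreal_leI)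
  also have "\<dots> \<le> lp_norm \<infinity> (off \<Psi> \<gamma>)" by (rule cmod_le_lp_norm) simp
  finally show ?thesis .
qed

text \<open>If \<open>\<bar>\<Psi>\<^sub>k\<bar> > b (m + 1)\<close>, then at most as many indices \<open>l\<close> satisfy \<open>\<bar>\<Psi>\<^sub>l\<bar> \<ge> \<bar>\<Psi>\<^sub>k\<bar>\<close> as there
  are \<open>j \<le> m\<close> with \<open>b j \<ge> \<bar>\<Psi>\<^sub>k\<bar>\<close>; the values of \<open>\<kappa>\<close> exhaust them, so \<open>k\<close> is one of these values.\<close>

lemma cmod_le_next:
  assumes \<kappa>: "\<kappa> ` {1..m} \<in> Gam m" "\<And>j. j \<in> {1..m} \<Longrightarrow> cmod (\<Psi> (\<kappa> j)) = b j"
    and k: "k \<notin> \<kappa> ` {1..m}"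
  shows "cmod (\<Psi> k) \<le> b (m + 1)"
proof (rule ccontr)
  assume "\<not> cmod (\<Psi> k) \<le> b (m + 1)"
  then have gt: "b (m + 1) < cmod (\<Psi> k)" by simp
  define T where "T = {j\<in>{1..}. cmod (\<Psi> k) \<le> b j}"
  define K where "K = {l. cmod (\<Psi> k) \<le> cmod (\<Psi> l)}"
  have T: "T \<subseteq> {1..m}"
  proof
    fix j assume j: "j \<in> T"
    then have "\<not> m + 1 \<le> j" using b_mono[of "m + 1" j] gt by (auto simp: T_def)
    with j show "j \<in> {1..m}" by (auto simp: T_def)
  qed
  have "K \<subseteq> \<sigma> ` T"
  proof
    fix l assume "l \<in> K"
    moreover obtain j where "j \<ge> 1" "l = \<sigma> j" using bij by (auto simp: bij_betw_def)
    ultimately show "l \<in> \<sigma> ` T" using b by (auto simp: K_def T_def)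
  qed
  moreover have "finite T" using T finite_subset by blast
  ultimately have K: "finite K" "card K \<le> card T"
    using surj_card_le by (auto intro: finite_subset)
  have "inj_on \<kappa> {1..m}"
    using \<kappa>(1) by (intro eq_card_imp_inj_on) (auto simp: Gam_def)
  then have "card (\<kappa> ` T) = card T" using T by (auto intro: card_image inj_on_subset)
  moreover have "\<kappa> ` T \<subseteq> K" using T \<kappa>(2) by (auto simp: T_def K_def)
  ultimately have "\<kappa> ` T = K" using K by (intro card_seteq) auto
  then have "k \<in> \<kappa> ` T" by (simp add: K_def)
  with k T show False by blast
qed

text \<open>Equal moduli may allow several choices of leading indices, so \<open>\<kappa>\<close> is
  not tied to \<open>\<sigma>\<close>; \<open>cmod_le_next\<close> bounds every index left
  over.\<close>

lemma lp_norm_infinity_off_extremal: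
  assumes \<kappa>: "\<kappa> ` {1..m} \<in> Gam m" "\<And>j. j \<in> {1..m} \<Longrightarrow> cmod (\<Psi> (\<kappa> j)) = b j"
  shows "lp_norm \<infinity> (off \<Psi> (\<kappa> ` {1..m})) = ennreal (b (m + 1))"
proof (rule antisym)
  show "lp_norm \<infinity> (off \<Psi> (\<kappa> ` {1..m})) \<le> ennreal (b (m + 1))"
    using cmod_le_next[OF \<kappa>] b_nonneg[of "m + 1"]
    by (auto simp: lp_norm_def off_def intro!: SUP_least ennreal_leI)
qed (rule lp_norm_infinity_off_ge[OF \<kappa>(1)])

text \<open>Expressing the tail as total minus initial sum matches the form of
  \<open>lp_norm_off\<close>, which reduces comparisons of infinite sums to comparisons of
  \<open>m\<close>-term sums.\<close>

lemma infsum_tail: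
  assumes s: "(\<lambda>k. cmod (\<Psi> k) powr r) summable_on UNIV"
  shows "(\<Sum>\<^sub>\<infinity>j\<in>{m + 1..}. b j powr r) = (\<Sum>\<^sub>\<infinity>k. cmod (\<Psi> k) powr r) - (\<Sum>j=1..m. b j powr r)"
proof -
  let ?h = "\<lambda>j. b j powr r"
  have "(\<lambda>j. cmod (\<Psi> (\<sigma> j)) powr r) summable_on {1..}"
    using s summable_on_reindex_bij_betw[OF bij, of "\<lambda>k. cmod (\<Psi> k) powr r"] by simp
  then have sh: "?h summable_on {1..}"
    by (rule summable_on_cong[THEN iffD1, rotated]) (simp add: b)
  have "infsum (\<lambda>k. cmod (\<Psi> k) powr r) UNIV = infsum (\<lambda>j. cmod (\<Psi> (\<sigma> j)) powr r) {1..}"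
    by (rule infsum_reindex_bij_betw[OF bij, symmetric])
  also have "\<dots> = infsum ?h {1..}" by (rule infsum_cong) (simp add: b)
  also have "{1..} = {1..m} \<union> {m + 1..}" by auto
  also have "infsum ?h \<dots> = infsum ?h {1..m} + infsum ?h {m + 1..}"
    using sh by (intro infsum_Un_disjoint) (auto intro: summable_on_subset_banach)
  finally show ?thesis by simp
qed

lemma lp_norm_off_ge:
  assumes \<gamma>: "\<gamma> \<in> Gam m" and p: "0 < p" "p \<noteq> \<infinity>"
    and s: "(\<lambda>k. cmod (\<Psi> k) powr enn2real p) summable_on UNIV"
  shows "ennreal ((\<Sum>\<^sub>\<infinity>j\<in>{m + 1..}. b j powr enn2real p) powr (1 / enn2real p))
     \<le> lp_norm p (off \<Psi> \<gamma>)"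
proof -
  let ?r = "enn2real p"
  \<comment> \<open>The positions of the members of \<open>\<gamma>\<close> in the sorted order;
    \<open>\<sigma>\<close> turns the sum over \<open>\<gamma>\<close> into a sum of
    \<open>b\<close> over \<open>J\<close>, to be compared with the first \<open>m\<close>
    terms.\<close>
  define J where "J = {j\<in>{1..}. \<sigma> j \<in> \<gamma>}"
  have J: "\<sigma> ` J = \<gamma>" "J \<subseteq> {1..}" "inj_on \<sigma> J"
    using bij inj_on_\<sigma>[of J] by (fastforce simp: J_def bij_betw_def)+
  have fin: "finite \<gamma>" "card \<gamma> = m" using \<gamma> by (auto simp: Gam_def)
  then have "finite J" "card J = m"
    using J finite_image_iff[of \<sigma> J] card_image[of \<sigma> J] by auto
  have "(\<Sum>k\<in>\<gamma>. cmod (\<Psi> k) powr ?r) = (\<Sum>j\<in>J. b j powr ?r)"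
    using J by (auto simp: J(1)[symmetric] sum.reindex b intro!: sum.cong simp del: J(1))
  also have "\<dots> \<le> (\<Sum>j=1..m. b j powr ?r)"
    unfolding \<open>card J = m\<close>[symmetric]
    using \<open>finite J\<close> J(2)
    by (intro sum_antimono_le_initial) (auto simp: monotone_on_def intro!: powr_mono2 b_mono b_nonneg)
  finally have "(\<Sum>\<^sub>\<infinity>j\<in>{m + 1..}. b j powr ?r) \<le> (\<Sum>\<^sub>\<infinity>k\<in>- \<gamma>. cmod (\<Psi> k) powr ?r)"
    by (simp only: infsum_tail[OF s] lp_norm_off(2)[OF fin(1) p(2) s])
  then show ?thesis
    unfolding lp_norm_off(1)[OF fin(1) p(2) s]
    by (intro ennreal_leI powr_mono2 infsum_nonneg) auto
qed

lemma lp_norm_off_extremal: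
  assumes \<kappa>: "\<kappa> ` {1..m} \<in> Gam m" "\<And>j. j \<in> {1..m} \<Longrightarrow> cmod (\<Psi> (\<kappa> j)) = b j"
    and p: "p \<noteq> \<infinity>"
    and s: "(\<lambda>k. cmod (\<Psi> k) powr enn2real p) summable_on UNIV"
  shows "lp_norm p (off \<Psi> (\<kappa> ` {1..m}))
     = ennreal ((\<Sum>\<^sub>\<infinity>j\<in>{m + 1..}. b j powr enn2real p) powr (1 / enn2real p))"
proof -
  \<comment> \<open>The image of \<open>m\<close> positions has \<open>m\<close> elements, so
    membership in \<open>Gam m\<close> encodes that the chosen indices are distinct.\<close>
  have inj: "inj_on \<kappa> {1..m}"
    using \<kappa>(1) by (intro eq_card_imp_inj_on) (auto simp: Gam_def)
  have "(\<Sum>k\<in>\<kappa> ` {1..m}. cmod (\<Psi> k) powr enn2real p) = (\<Sum>j=1..m. b j powr enn2real p)"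
    unfolding sum.reindex[OF inj] using \<kappa>(2) by (intro sum.cong) auto
  then show ?thesis
    using lp_norm_off[OF _ p s, of "\<kappa> ` {1..m}"] infsum_tail[OF s, of m] by simp
qed

text \<open>\<open>V\<close> is a lower bound over all spectra and is attained at the leading
  indices, so the infimum is a minimum. The two widths agree because the errors agree for each
  spectrum.\<close>

lemma widths_eq:
  assumes eq: "\<And>\<gamma>. \<gamma> \<in> Gam m \<Longrightarrow> fourier_approx_class p \<gamma> (F_class q \<Psi>) = lp_norm p (off \<Psi> \<gamma>)"
    and ge: "\<And>\<gamma>. \<gamma> \<in> Gam m \<Longrightarrow> V \<le> lp_norm p (off \<Psi> \<gamma>)"
    and extremal: "lp_norm p (off \<Psi> (\<sigma> ` {1..m})) = V"
  shows "projection_width p m (F_class q \<Psi>) = V" "basis_width p m (F_class q \<Psi>) = V"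
proof -
  show *: "projection_width p m (F_class q \<Psi>) = V"
    unfolding projection_width_def
  proof (rule antisym)
    show "(INF \<gamma>\<in>Gam m. fourier_approx_class p \<gamma> (F_class q \<Psi>)) \<le> V"
      using \<sigma>_image_Gam eq extremal by (auto intro: INF_lower2)
  qed (use eq ge in \<open>auto intro: INF_greatest\<close>)
  have "basis_width p m (F_class q \<Psi>) = projection_width p m (F_class q \<Psi>)"
    unfolding basis_width_def projection_width_def
    by (intro INF_cong refl best_approx_class_eq_fourier_approx_class) (simp add: Gam_def)
  with * show "basis_width p m (F_class q \<Psi>) = V" by simp
qed

end

section \<open>Errors through the ordered values outside the spectrum\<close>

lemma lp_norm_infinity_off_eq_jth_largest:
  assumes "nonincreasing_rearrangement (\<lambda>k. cmod (\<Psi> k)) b" and "finite \<gamma>"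
  shows "lp_norm \<infinity> (off \<Psi> \<gamma>) = ennreal (jth_largest (\<lambda>k. cmod (off \<Psi> \<gamma> k)) 1)"
proof -
  obtain \<tau> where \<tau>: "bij_betw \<tau> {1..} (- \<gamma>)"
    "\<And>j. j \<ge> 1 \<Longrightarrow> jth_largest (\<lambda>k. cmod (off \<Psi> \<gamma> k)) j = cmod (\<Psi> (\<tau> j))"
    "\<And>k. cmod (off \<Psi> \<gamma> k) \<le> cmod (\<Psi> (\<tau> 1))"
    using rearrangement_off[OF assms] by blast
  have "\<tau> 1 \<in> - \<gamma>" using bij_betw_apply[OF \<tau>(1), of 1] by simp
  then have "off \<Psi> \<gamma> (\<tau> 1) = \<Psi> (\<tau> 1)" by (simp add: off_def)
  \<comment> \<open>The supremum is attained at \<open>\<tau> 1\<close>, the first index that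
    survives the removal of \<open>\<gamma>\<close>.\<close>
  then have "(SUP k. ennreal (cmod (off \<Psi> \<gamma> k))) = ennreal (cmod (\<Psi> (\<tau> 1)))"
    using \<tau>(3) by (intro antisym SUP_least) (auto intro: ennreal_leI SUP_upper2[of "\<tau> 1"])
  with \<tau>(2)[of 1] show ?thesis by (simp add: lp_norm_def)
qed

text \<open>\<open>\<tau>\<close> reindexes the complement of \<open>\<gamma>\<close> by the
  positive integers, and its moduli are the ordered values of
  \<open>off \<Psi> \<gamma>\<close>.\<close>

lemma lp_norm_off_eq_jth_largest:
  assumes "nonincreasing_rearrangement (\<lambda>k. cmod (\<Psi> k)) b" and "finite \<gamma>" and "p \<noteq> \<infinity>"
    and "(\<lambda>k. cmod (\<Psi> k) powr enn2real p) summable_on UNIV"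
  shows "lp_norm p (off \<Psi> \<gamma>)
     = ennreal ((\<Sum>\<^sub>\<infinity>j\<in>{1..}. jth_largest (\<lambda>k. cmod (off \<Psi> \<gamma> k)) j powr enn2real p)
         powr (1 / enn2real p))"
proof -
  obtain \<tau> where \<tau>: "bij_betw \<tau> {1..} (- \<gamma>)"
    "\<And>j. j \<ge> 1 \<Longrightarrow> jth_largest (\<lambda>k. cmod (off \<Psi> \<gamma> k)) j = cmod (\<Psi> (\<tau> j))"
    using rearrangement_off[OF assms(1,2)] by blast
  have "(\<Sum>\<^sub>\<infinity>k\<in>- \<gamma>. cmod (\<Psi> k) powr enn2real p) = (\<Sum>\<^sub>\<infinity>j\<in>{1..}. cmod (\<Psi> (\<tau> j)) powr enn2real p)"
    by (rule infsum_reindex_bij_betw[OF \<tau>(1), symmetric])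
  also have "\<dots> = (\<Sum>\<^sub>\<infinity>j\<in>{1..}. jth_largest (\<lambda>k. cmod (off \<Psi> \<gamma> k)) j powr enn2real p)"
    by (rule infsum_cong) (simp add: \<tau>(2))
  finally show ?thesis using lp_norm_off(1)[OF assms(2-4)] by simp
qed

theorem theorem1:
  fixes \<Psi> :: "int ^ 'd \<Rightarrow> complex" and \<Psi>bar :: "nat \<Rightarrow> real"
    and m :: nat and p q :: ennreal
  assumes "m \<ge> 1"
    and "\<forall>k. \<Psi> k \<noteq> 0"
    and "nonincreasing_rearrangement (\<lambda>k. cmod (\<Psi> k)) \<Psi>bar"
  shows
    "((0 < q \<and> q < p \<and> p = \<infinity>) \<or> (p = \<infinity> \<and> q = \<infinity>) \<longrightarrow>
        (\<forall>\<gamma>\<in>Gam m.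
           best_approx_class p \<gamma> (F_class q \<Psi>) = fourier_approx_class p \<gamma> (F_class q \<Psi>) \<and>
           fourier_approx_class p \<gamma> (F_class q \<Psi>)
             = ennreal (jth_largest (\<lambda>k. cmod (off \<Psi> \<gamma> k)) 1)) \<and>
        basis_width p m (F_class q \<Psi>) = projection_width p m (F_class q \<Psi>) \<and>
        projection_width p m (F_class q \<Psi>) = ennreal (\<Psi>bar (m + 1)))
     \<and>
     (0 < p \<and> p < q \<and> q = \<infinity> \<and> (\<lambda>k. cmod (\<Psi> k) powr enn2real p) summable_on UNIV \<longrightarrow>
        (\<forall>\<gamma>\<in>Gam m.
           best_approx_class p \<gamma> (F_class q \<Psi>) = fourier_approx_class p \<gamma> (F_class q \<Psi>) \<and>
           fourier_approx_class p \<gamma> (F_class q \<Psi>)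
             = ennreal ((\<Sum>\<^sub>\<infinity>j\<in>{1..}. jth_largest (\<lambda>k. cmod (off \<Psi> \<gamma> k)) j powr enn2real p)
                          powr (1 / enn2real p))) \<and>
        basis_width p m (F_class q \<Psi>) = projection_width p m (F_class q \<Psi>) \<and>
        projection_width p m (F_class q \<Psi>)
          = ennreal ((\<Sum>\<^sub>\<infinity>j\<in>{m + 1..}. \<Psi>bar j powr enn2real p) powr (1 / enn2real p)))
     \<and>
     ((0 < q \<and> q < p \<and> p = \<infinity>) \<or> (p = \<infinity> \<and> q = \<infinity>) \<or>
      (0 < p \<and> p < q \<and> q = \<infinity> \<and> (\<lambda>k. cmod (\<Psi> k) powr enn2real p) summable_on UNIV) \<longrightarrow>
        (\<forall>\<kappa> :: nat \<Rightarrow> int ^ 'd.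
           \<kappa> ` {1..m} \<in> Gam m \<and> (\<forall>j\<in>{1..m}. cmod (\<Psi> (\<kappa> j)) = \<Psi>bar j) \<longrightarrow>
           basis_width p m (F_class q \<Psi>) = projection_width p m (F_class q \<Psi>) \<and>
           projection_width p m (F_class q \<Psi>)
             = best_approx_class p (\<kappa> ` {1..m}) (F_class q \<Psi>) \<and>
           best_approx_class p (\<kappa> ` {1..m}) (F_class q \<Psi>)
             = fourier_approx_class p (\<kappa> ` {1..m}) (F_class q \<Psi>)))"
proof -
  obtain \<sigma> where \<sigma>: "antimono_on {1..} \<Psi>bar" "bij_betw \<sigma> {1..} UNIV"
    "\<And>j. j \<ge> 1 \<Longrightarrow> \<Psi>bar j = cmod (\<Psi> (\<sigma> j))"
    using assms(3) by (auto simp: nonincreasing_rearrangement_def)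
  let ?best = "\<lambda>\<gamma>. best_approx_class p \<gamma> (F_class q \<Psi>)"
  let ?fourier = "\<lambda>\<gamma>. fourier_approx_class p \<gamma> (F_class q \<Psi>)"
  let ?case1 = "(0 < q \<and> q < p \<and> p = \<infinity>) \<or> (p = \<infinity> \<and> q = \<infinity>)"
  let ?case2 = "0 < p \<and> p < q \<and> q = \<infinity> \<and> (\<lambda>k. cmod (\<Psi> k) powr enn2real p) summable_on UNIV"
  have fin: "finite \<gamma>" if "\<gamma> \<in> Gam m" for \<gamma> :: "(int ^ 'd) set" using that by (simp add: Gam_def)
  have best: "?best \<gamma> = ?fourier \<gamma>" if "\<gamma> \<in> Gam m" for \<gamma>
    using fin[OF that] by (rule best_approx_class_eq_fourier_approx_class)
  have fourier: "?fourier \<gamma> = lp_norm p (off \<Psi> \<gamma>)" if "?case1 \<or> ?case2" "\<gamma> \<in> Gam m" for \<gamma>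
    using assms(2) fin[OF that(2)] that(1) by (intro fourier_approx_class_eq) auto
  have val: "\<Psi>bar j = cmod (\<Psi> (\<sigma> j))" if "j \<in> {1..m}" for j using that \<sigma>(3) by simp
  \<comment> \<open>The common value of both widths, with the two ranges of parameters distinguished
    by whether \<open>p\<close> is infinite.\<close>
  define V where "V = (if p = \<infinity> then ennreal (\<Psi>bar (m + 1))
    else ennreal ((\<Sum>\<^sub>\<infinity>j\<in>{m + 1..}. \<Psi>bar j powr enn2real p) powr (1 / enn2real p)))"
  \<comment> \<open>Stated for arbitrary \<open>\<kappa>\<close>: the instance
    \<open>\<sigma>\<close> yields the widths, the general form the final claim on extremal
    spectra.\<close>
  have extremal: "lp_norm p (off \<Psi> (\<kappa> ` {1..m})) = V"
    if "?case1 \<or> ?case2" "\<kappa> ` {1..m} \<in> Gam m" "\<And>j. j \<in> {1..m} \<Longrightarrow> cmod (\<Psi> (\<kappa> j)) = \<Psi>bar j"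
    for \<kappa>
    using that lp_norm_infinity_off_extremal[OF \<sigma> that(2,3)] lp_norm_off_extremal[OF \<sigma> that(2,3)]
    by (auto simp: V_def)
  have ge: "V \<le> lp_norm p (off \<Psi> \<gamma>)" if "?case1 \<or> ?case2" "\<gamma> \<in> Gam m" for \<gamma>
    using that lp_norm_infinity_off_ge[OF \<sigma>] lp_norm_off_ge[OF \<sigma>] by (auto simp: V_def)
  have widths: "projection_width p m (F_class q \<Psi>) = V" "basis_width p m (F_class q \<Psi>) = V"
    if "?case1 \<or> ?case2"
    using widths_eq[OF \<sigma> fourier[OF that] ge[OF that]]
      extremal[OF that \<sigma>_image_Gam[OF \<sigma>] val[symmetric]] by auto
  show ?thesis
  proof (intro conjI impI)
    assume case1: ?case1
    then show "\<forall>\<gamma>\<in>Gam m. ?best \<gamma> = ?fourier \<gamma> \<and>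
        ?fourier \<gamma> = ennreal (jth_largest (\<lambda>k. cmod (off \<Psi> \<gamma> k)) 1)"
      using best fourier fin lp_norm_infinity_off_eq_jth_largest[OF assms(3)] by auto
    from case1 show "basis_width p m (F_class q \<Psi>) = projection_width p m (F_class q \<Psi>)"
      using widths by simp
    from case1 show "projection_width p m (F_class q \<Psi>) = ennreal (\<Psi>bar (m + 1))"
      using widths by (auto simp: V_def)
  next
    assume case2: ?case2
    then have "p \<noteq> \<infinity>" by auto
    with case2 show "\<forall>\<gamma>\<in>Gam m. ?best \<gamma> = ?fourier \<gamma> \<and> ?fourier \<gamma>
        = ennreal ((\<Sum>\<^sub>\<infinity>j\<in>{1..}. jth_largest (\<lambda>k. cmod (off \<Psi> \<gamma> k)) j powr enn2real p)
            powr (1 / enn2real p))"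
      using best fourier fin lp_norm_off_eq_jth_largest[OF assms(3)] by auto
    from case2 have "?case1 \<or> ?case2" by (rule disjI2)
    from widths[OF this] show "basis_width p m (F_class q \<Psi>) = projection_width p m (F_class q \<Psi>)"
      by (simp only:)
    from case2 show "projection_width p m (F_class q \<Psi>)
        = ennreal ((\<Sum>\<^sub>\<infinity>j\<in>{m + 1..}. \<Psi>bar j powr enn2real p) powr (1 / enn2real p))"
      using widths(1)[OF \<open>?case1 \<or> ?case2\<close>] \<open>p \<noteq> \<infinity>\<close> by (simp add: V_def)
  next
    assume "(0 < q \<and> q < p \<and> p = \<infinity>) \<or> (p = \<infinity> \<and> q = \<infinity>) \<or> ?case2"
    then have "?case1 \<or> ?case2" by blast
    then show "\<forall>\<kappa>. \<kappa> ` {1..m} \<in> Gam m \<and> (\<forall>j\<in>{1..m}. cmod (\<Psi> (\<kappa> j)) = \<Psi>bar j) \<longrightarrow>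
        basis_width p m (F_class q \<Psi>) = projection_width p m (F_class q \<Psi>) \<and>
        projection_width p m (F_class q \<Psi>) = ?best (\<kappa> ` {1..m}) \<and>
        ?best (\<kappa> ` {1..m}) = ?fourier (\<kappa> ` {1..m})"
      using widths extremal fourier best by simp
  qed
qed

end
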